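(* Let $n\ge 1$ and let $p_1,\ldots,p_n:[0,1]\to[0,1]$ be affine functions with $p_i'\ge 0$ for all $i$. For $t\in[0,1]$ let $(f_k(t))_{k=0,\ldots,n}$ be the probability mass function of $B_1+\cdots+B_n$, where $B_1,\ldots,B_n$ are independent Bernoulli random variables with parameters $p_1(t),\ldots,p_n(t)$. Then the entropy $$H(t) := -\sum_{k=0}^n f_k(t)\log f_k(t)$$ (with the convention $0\log 0=0$) is a concave function of $t\in[0,1]$.
   Context: An affine function $p_i:[0,1]\to[0,1]$ has the form $p_i(t)=(1-t)p_i(0)+t\,p_i(1)$; $p_i'$ denotes its (constant) derivative. *)

theory Defs
  imports "HOL-Probability.Probability"
begin

fun poibin :: "(nat \<Rightarrow> real) \<Rightarrow> nat \<Rightarrow> nat pmf" where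
  "poibin q 0 = return_pmf 0"
| "poibin q (Suc n) =
     do { s \<leftarrow> poibin q n; b \<leftarrow> bernoulli_pmf (q n); return_pmf (s + (if b then 1 else 0)) }"

definition xlogx :: "real \<Rightarrow> real" where
  "xlogx x = (if x = 0 then 0 else x * ln x)"

definition affine01 :: "(real \<Rightarrow> real) \<Rightarrow> bool" where
  "affine01 f \<longleftrightarrow> f 0 \<in> {0..1} \<and> f 1 \<in> {0..1} \<and> (\<forall>t\<in>{0..1}. f t = (1 - t) * f 0 + t * f 1)"

end

theory Submission
  imports Defs "HOL-Real_Asymp.Real_Asymp"
begin

text \<open>
  Write \<open>f\<^sub>k\<close> for the masses, \<open>w\<^sub>i = p\<^sub>i'\<close>, and let a superscript denote the omission of indices.
  With \<open>g\<^sub>k = \<Sum>\<^sub>i w\<^sub>i f\<^sub>k\<^sup>i\<close> and \<open>h\<^sub>k = \<Sum>\<^sub>i\<^sub>\<noteq>\<^sub>j w\<^sub>i w\<^sub>j f\<^sub>k\<^sup>i\<^sup>j\<close> one has \<open>f\<^sub>k' = g\<^sub>k\<^sub>-\<^sub>1 - g\<^sub>k\<close> and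
  \<open>g\<^sub>k' = h\<^sub>k\<^sub>-\<^sub>1 - h\<^sub>k\<close>, so summation by parts reduces \<open>H'' \<le> 0\<close> to the local bound
  \<open>h\<^sub>k ln (b\<^sup>2 / (a c)) \<le> x\<^sup>2 / a + y\<^sup>2 / c - 2 x y / b\<close> for \<open>(a, b, c) = (f\<^sub>k, f\<^sub>k\<^sub>+\<^sub>1, f\<^sub>k\<^sub>+\<^sub>2)\<close> and
  \<open>(x, y) = (g\<^sub>k, g\<^sub>k\<^sub>+\<^sub>1)\<close>.

  The numbers \<open>a, b, c, x, y, h\<^sub>k\<close> are, up to binomial weights, the entries of a quadratic form
  obtained by differentiating a product of linear forms with nonnegative coefficients; such a form
  is Lorentzian. Here this appears as a Newton inequality
  \<open>(n - k) f\<^sub>k h\<^sub>k \<le> (n - k - 1) g\<^sub>k\<^sup>2\<close> that holds for arbitrary real weights \<open>w\<close>. Replacing \<open>w\<close> by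
  \<open>w + \<beta> p\<close> for all real \<open>\<beta>\<close> yields the determinant and the minor inequalities of the form, and these
  imply the local bound through \<open>ln s\<^sup>2 \<le> s - 1 / s\<close> for \<open>s \<ge> 1\<close>.
\<close>

section \<open>Masses of Bernoulli sums and their weighted variants\<close>

text \<open>Masses are indexed by integers, so that the recursions need no boundary cases. In
  \<open>mass1\<close> one factor of \<open>\<Prod>i<n. (1 - p i + p i * z)\<close> is replaced by its weight \<open>d i\<close>, in \<open>mass2\<close>
  two of them are (summed over ordered pairs).\<close>

primrec mass :: "(nat \<Rightarrow> real) \<Rightarrow> nat \<Rightarrow> int \<Rightarrow> real" where
  "mass p 0 = (\<lambda>k. if k = 0 then 1 else 0)"
| "mass p (Suc n) = (\<lambda>k. (1 - p n) * mass p n k + p n * mass p n (k - 1))"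

primrec mass1 :: "(nat \<Rightarrow> real) \<Rightarrow> (nat \<Rightarrow> real) \<Rightarrow> nat \<Rightarrow> int \<Rightarrow> real" where
  "mass1 p d 0 = (\<lambda>k. 0)"
| "mass1 p d (Suc n) =
     (\<lambda>k. (1 - p n) * mass1 p d n k + p n * mass1 p d n (k - 1) + d n * mass p n k)"

primrec mass2 :: "(nat \<Rightarrow> real) \<Rightarrow> (nat \<Rightarrow> real) \<Rightarrow> nat \<Rightarrow> int \<Rightarrow> real" where
  "mass2 p d 0 = (\<lambda>k. 0)"
| "mass2 p d (Suc n) =
     (\<lambda>k. (1 - p n) * mass2 p d n k + p n * mass2 p d n (k - 1) + 2 * d n * mass1 p d n k)"

lemma mass_eq_0: "k < 0 \<or> int n < k \<Longrightarrow> mass p n k = 0"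
  by (induction n arbitrary: k) auto

lemma mass1_eq_0: "k < 0 \<or> int n \<le> k \<Longrightarrow> mass1 p d n k = 0"
  by (induction n arbitrary: k) (auto simp: mass_eq_0)

lemma mass2_eq_0: "k < 0 \<or> int n \<le> k + 1 \<Longrightarrow> mass2 p d n k = 0"
  by (induction n arbitrary: k) (auto simp: mass1_eq_0)

lemma mass_nonneg: "(\<And>i. i < n \<Longrightarrow> 0 \<le> p i \<and> p i \<le> 1) \<Longrightarrow> 0 \<le> mass p n k"
  by (induction n arbitrary: k) auto

lemma mass1_nonneg:
  "(\<And>i. i < n \<Longrightarrow> 0 \<le> p i \<and> p i \<le> 1) \<Longrightarrow> (\<And>i. i < n \<Longrightarrow> 0 \<le> d i) \<Longrightarrow> 0 \<le> mass1 p d n k"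
  by (induction n arbitrary: k) (auto simp: mass_nonneg)

lemma mass2_nonneg:
  "(\<And>i. i < n \<Longrightarrow> 0 \<le> p i \<and> p i \<le> 1) \<Longrightarrow> (\<And>i. i < n \<Longrightarrow> 0 \<le> d i) \<Longrightarrow> 0 \<le> mass2 p d n k"
  by (induction n arbitrary: k) (auto simp: mass1_nonneg)

lemma mass_pos:
  "(\<And>i. i < n \<Longrightarrow> 0 < p i \<and> p i < 1) \<Longrightarrow> 0 \<le> k \<Longrightarrow> k \<le> int n \<Longrightarrow> 0 < mass p n k"
proof (induction n arbitrary: k)
  case (Suc n)
  have p: "0 < p n" "p n < 1" using Suc.prems(1)[of n] by auto
  have nonneg: "0 \<le> mass p n j" for j
    using Suc.prems(1) by (intro mass_nonneg) (auto simp: less_Suc_eq intro: less_imp_le)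
  show ?case
  proof (cases "k = 0")
    case True
    then have "0 < mass p n k" using Suc by auto
    then show ?thesis using p nonneg[of "k - 1"] by (auto intro: add_pos_nonneg)
  next
    case False
    then have "0 < mass p n (k - 1)" using Suc by auto
    then show ?thesis using p nonneg[of k] by (auto intro: add_nonneg_pos)
  qed
qed auto

text \<open>The direction \<open>d = p\<close> differentiates the generating function, so adding a multiple of it
  to \<open>d\<close> brings in the neighbouring masses.\<close>

lemma mass1_shift:
  "mass1 p (\<lambda>i. d i + \<beta> * p i) n k = mass1 p d n k + \<beta> * (of_int k + 1) * mass p n (k + 1)"
proof (induction n arbitrary: k)
  case 0
  then show ?case by (cases "k = -1") auto
next
  case (Suc n)
  then show ?case by (simp add: algebra_simps)
qed

lemma mass2_shift:
  "mass2 p (\<lambda>i. d i + \<beta> * p i) n k = mass2 p d n k + 2 * \<beta> * (of_int k + 1) * mass1 p d n (k + 1)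
     + \<beta>\<^sup>2 * (of_int k + 1) * (of_int k + 2) * mass p n (k + 2)"
proof (induction n arbitrary: k)
  case 0
  then show ?case by (cases "k = -2") auto
next
  case (Suc n)
  then show ?case by (simp add: mass1_shift algebra_simps power2_eq_square)
qed

section \<open>The discriminant criterion and the Newton inequality\<close>

lemma quadratic_nonneg_imp:
  fixes c0 c1 c2 :: real
  assumes "\<And>\<beta>. 0 \<le> c0 + 2 * c1 * \<beta> + c2 * \<beta>\<^sup>2"
  shows "0 \<le> c0" "0 \<le> c2" "c1\<^sup>2 \<le> c0 * c2"
proof -
  show c0: "0 \<le> c0" using assms[of 0] by simp
  show c2: "0 \<le> c2"
  proof (rule ccontr)
    assume n: "\<not> 0 \<le> c2"
    \<comment> \<open>\<open>B\<close> solves -c2 B = -c2 + 2 |c1| + c0; since B >= 1, the leading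
      term then outweighs the other two at \<open>B\<close>.\<close>
    define B where "B = 1 + (2 * \<bar>c1\<bar> + c0) / (- c2)"
    have B: "1 \<le> B" using n c0 by (simp add: B_def divide_le_0_iff)
    have eq: "- c2 * B = - c2 + 2 * \<bar>c1\<bar> + c0" using n by (simp add: B_def field_simps)
    have "- c2 * B\<^sup>2 = (- c2 * B) * B" by (simp add: power2_eq_square)
    also have "\<dots> = (- c2 + 2 * \<bar>c1\<bar> + c0) * B" by (simp only: eq)
    also have "\<dots> = - c2 * B + 2 * \<bar>c1\<bar> * B + c0 * B" by (simp add: algebra_simps)
    also have "\<dots> > 2 * \<bar>c1\<bar> * B + c0"
      using n B c0 mult_left_mono[of 1 B c0] mult_neg_pos[of c2 B] by simp
    finally have "c0 + 2 * \<bar>c1\<bar> * B + c2 * B\<^sup>2 < 0" by simp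
    moreover have "c1 * B \<le> \<bar>c1\<bar> * B" using B by (intro mult_right_mono) auto
    ultimately show False using assms[of B] by simp
  qed
  show "c1\<^sup>2 \<le> c0 * c2"
  proof (cases "c2 = 0")
    case True
    have "c1 = 0"
    proof (rule ccontr)
      assume "c1 \<noteq> 0"
      \<comment> \<open>For c2 = 0 the polynomial has the value -1 at this point.\<close>
      then show False using assms[of "- (c0 + 1) / (2 * c1)"] True by simp
    qed
    then show ?thesis using True by simp
  next
    case False
    then have "0 < c2" using c2 by simp
    then show ?thesis using assms[of "- c1 / c2"] by (simp add: field_simps power2_eq_square)
  qed
qed

text \<open>In the inductive step the difference of the two sides is a quadratic polynomial in the new
  weight \<open>d n\<close>. Its discriminant splits into the quantity \<open>A\<close>, controlled by the hypothesis at
  \<open>k\<close>, and \<open>W\<close>, controlled by the hypothesis at \<open>k - 1\<close> for all the weights \<open>d + \<beta> p\<close>.\<close>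

lemma mass_newton:
  assumes "\<And>i. i < n \<Longrightarrow> 0 < p i \<and> p i < 1"
  shows "(real n - of_int k) * mass p n k * mass2 p d n k
           \<le> (real n - of_int k - 1) * (mass1 p d n k)\<^sup>2"
  using assms
proof (induction n arbitrary: k d)
  case (Suc n)
  have pn: "0 < p n" "p n < 1" using Suc.prems[of n] by auto
  have ps: "\<And>i. i < n \<Longrightarrow> 0 < p i \<and> p i < 1" using Suc.prems by auto
  consider "k < 0 \<or> int n \<le> k" | "0 \<le> k" "k < int n" by linarith
  then show ?case
  proof cases
    case 1
    then have "mass2 p d (Suc n) k = 0" by (intro mass2_eq_0) auto
    \<comment> \<open>At k = n the factor (n + 1) - k - 1 on the right vanishes; otherwise
      \<open>mass1\<close> does.\<close>
    moreover have "k = int n \<or> mass1 p d (Suc n) k = 0" using 1 mass1_eq_0[of k "Suc n" p d] by linarith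
    ultimately show ?thesis by (auto simp del: mass1.simps mass2.simps)
  next
    case 2
    define m where "m = real n - of_int k"
    have m: "1 \<le> m" using 2 unfolding m_def by linarith
    define F G H where "F = mass p n k" and "G = mass1 p d n k" and "H = mass2 p d n k"
    define F' G' H' where "F' = mass p n (k - 1)" and "G' = mass1 p d n (k - 1)"
      and "H' = mass2 p d n (k - 1)"
    define A where "A = (m - 1) * G\<^sup>2 - m * F * H"
    define W where "W = 2 * m * F * G * G' - m * F\<^sup>2 * H' - (m + 1) * F' * G\<^sup>2"
    have F: "0 < F" unfolding F_def using 2 by (intro mass_pos ps) auto
    have A: "0 \<le> A" using Suc.IH[OF ps, of k d] by (simp add: A_def F_def G_def H_def m_def)
    have "0 \<le> W \<and> 0 \<le> F'"
    proof (cases "k = 0")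
      case True
      then show ?thesis
        by (simp add: W_def F'_def G'_def H'_def mass_eq_0 mass1_eq_0 mass2_eq_0)
    next
      case False
      then have k: "1 \<le> k" using 2 by simp
      define K where "K = real_of_int k"
      have K: "1 \<le> K" using k by (simp add: K_def)
      have F': "0 < F'" unfolding F'_def using 2 k by (intro mass_pos ps) auto
      have F2: "0 \<le> mass p n (k + 1)" using ps by (intro mass_nonneg) (auto intro: less_imp_le)
      \<comment> \<open>The hypothesis at k - 1 for the weights d + (\<beta> / k) p: the scaling
        cancels the factor k from the shift lemmas, and the nonnegative term with
        \<open>mass p n (k + 1)\<close> is dropped.\<close>
      have "0 \<le> (m * G'\<^sup>2 - (m + 1) * F' * H') + 2 * (m * G' * F - (m + 1) * F' * G) * \<beta>
               + (m * F\<^sup>2) * \<beta>\<^sup>2" for \<beta>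
      proof -
        have "(m + 1) * F' * (H' + 2 * (\<beta> / K) * K * G + (\<beta> / K)\<^sup>2 * K * (K + 1) * mass p n (k + 1))
            \<le> m * (G' + (\<beta> / K) * K * F)\<^sup>2"
          using Suc.IH[OF ps, of "k - 1" "\<lambda>i. d i + \<beta> / K * p i"]
          unfolding mass1_shift mass2_shift
          by (simp add: F_def G_def F'_def G'_def H'_def m_def K_def algebra_simps)
        moreover have "0 \<le> (m + 1) * F' * ((\<beta> / K)\<^sup>2 * K * (K + 1) * mass p n (k + 1))"
          using m F' K F2 by (intro mult_nonneg_nonneg) auto
        ultimately have "(m + 1) * F' * (H' + 2 * \<beta> * G) \<le> m * (G' + \<beta> * F)\<^sup>2"
          using K by (simp add: distrib_left)
        then show ?thesis by (simp add: algebra_simps power2_eq_square)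
      qed
      from quadratic_nonneg_imp(3)[OF this]
      have "0 \<le> (m + 1) * F' * W"
        unfolding W_def by (simp add: algebra_simps power2_eq_square)
      moreover have "0 < (m + 1) * F'" using F' m by simp
      ultimately have "0 \<le> W" by (rule mult_left_le_imp_le[of _ 0, simplified])
      then show ?thesis using F' by simp
    qed
    then have W: "0 \<le> W" and F': "0 \<le> F'" by auto
    \<comment> \<open>As a quadratic in \<open>d n\<close>, \<open>T\<close> below has leading
      coefficient \<open>a\<close> and linear coefficient 2b, so the identity for
      \<open>a * T\<close> completes the square.\<close>
    define a b where "a = m * F\<^sup>2"
      and "b = - (1 - p n) * F * G + p n * (m * F * G' - (m + 1) * F' * G)"
    define T where "T = m * ((1 - p n) * G + p n * G' + d n * F)\<^sup>2
      - (m + 1) * ((1 - p n) * F + p n * F') * ((1 - p n) * H + p n * H' + 2 * d n * G)"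
    have "a * T = (a * d n + b)\<^sup>2 + (1 - p n)\<^sup>2 * (m + 1) * F\<^sup>2 * A
       + p n * (1 - p n) * (m + 1) * F * (W + F' * A) + (p n)\<^sup>2 * (m + 1) * F' * W"
      unfolding a_def b_def T_def A_def W_def by algebra
    also have "\<dots> \<ge> 0"
      using A W F F' pn m by (intro add_nonneg_nonneg mult_nonneg_nonneg) auto
    finally have "0 \<le> a * T" .
    moreover have "0 < a" using m F by (simp add: a_def)
    ultimately have "0 \<le> T" by (simp add: zero_le_mult_iff)
    then show ?thesis
      by (simp add: T_def F_def G_def H_def F'_def G'_def H'_def m_def algebra_simps)
  qed
qed simp

section \<open>Logarithmic bounds\<close>

lemma ln_le_diff_inverse:
  fixes s :: real
  assumes "1 \<le> s"
  shows "2 * ln s \<le> s - 1 / s"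
proof -
  have "1 - 1 / 1 - 2 * ln 1 \<le> s - 1 / s - 2 * ln s"
  proof (rule DERIV_nonneg_imp_nondecreasing[OF assms, of "\<lambda>s. s - 1 / s - 2 * ln s"])
    fix x :: real assume x: "1 \<le> x"
    have "((\<lambda>s. s - 1 / s - 2 * ln s) has_real_derivative (1 - 1 / x)\<^sup>2) (at x)"
      using x by (auto intro!: derivative_eq_intros simp: field_simps power2_eq_square)
    then show "\<exists>y. ((\<lambda>s. s - 1 / s - 2 * ln s) has_real_derivative y) (at x) \<and> 0 \<le> y"
      using zero_le_power2 by blast
  qed
  then show ?thesis by simp
qed

text \<open>With e = sqrt (a c), the logarithm is 2 ln (b / e) <= b / e - e / b, and
  \<open>det\<close> bounds the resulting h (b^2 - e^2). What remains is the AM-GM inequality 2 e x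
  y <= c x^2 + a y^2 multiplied by b + e.\<close>

lemma log_bound:
  fixes a b c x y h :: real
  assumes pos: "0 < a" "0 < b" "0 < c" and nonneg: "0 \<le> h" "0 \<le> x" "0 \<le> y"
    and "a * c \<le> b\<^sup>2"
    and det: "h * (b\<^sup>2 - a * c) \<le> 2 * b * x * y - a * y\<^sup>2 - c * x\<^sup>2"
  shows "h * ln (b\<^sup>2 / (a * c)) \<le> x\<^sup>2 / a + y\<^sup>2 / c - 2 * x * y / b"
proof -
  define e where "e = sqrt (a * c)"
  have e: "0 < e" "e\<^sup>2 = a * c" using pos by (auto simp: e_def)
  have "e \<le> b" using \<open>a * c \<le> b\<^sup>2\<close> pos e by (metis power2_le_imp_le less_imp_le)
  define S where "S = c * x\<^sup>2 + a * y\<^sup>2"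
  have "S - 2 * e * x * y = (sqrt c * x - sqrt a * y)\<^sup>2"
    using pos by (simp add: S_def e_def power2_diff power_mult_distrib real_sqrt_mult)
  then have S: "2 * e * x * y \<le> S" by (smt (verit) zero_le_power2)
  have "ln (b\<^sup>2 / (a * c)) = 2 * ln (b / e)"
    using pos e by (simp add: ln_div ln_mult ln_realpow flip: e(2))
  also have "\<dots> \<le> b / e - e / b"
    using ln_le_diff_inverse[of "b / e"] \<open>e \<le> b\<close> e pos by simp
  finally have "h * ln (b\<^sup>2 / (a * c)) \<le> h * (b / e - e / b)"
    using nonneg by (intro mult_left_mono)
  also have "\<dots> = h * (b\<^sup>2 - a * c) / (b * e)"
    using e pos by (simp add: field_simps power2_eq_square flip: e(2))
  also have "\<dots> \<le> (2 * b * x * y - S) / (b * e)"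
    using det e pos by (intro divide_right_mono) (auto simp: S_def)
  also have "\<dots> \<le> S / e\<^sup>2 - 2 * x * y / b"
  proof -
    have "2 * e * x * y * (b + e) \<le> S * (b + e)"
      using S e pos by (intro mult_right_mono) auto
    then have "e * (2 * b * x * y - S) \<le> b * S - 2 * e\<^sup>2 * x * y"
      by (simp add: algebra_simps power2_eq_square)
    then have "e * (2 * b * x * y - S) / (b * e\<^sup>2) \<le> (b * S - 2 * e\<^sup>2 * x * y) / (b * e\<^sup>2)"
      using pos by (intro divide_right_mono) auto
    then show ?thesis
      using e(1) pos by (simp add: diff_divide_distrib power2_eq_square)
  qed
  also have "S / e\<^sup>2 = x\<^sup>2 / a + y\<^sup>2 / c"
    using pos by (simp add: S_def e(2) field_simps)
  finally show ?thesis .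
qed

text \<open>The factors \<open>\<rho>\<close> and \<open>\<sigma>\<close> are the binomial weights \<open>(n - k) / (n - k - 1)\<close> and
  \<open>(k + 2) / (k + 1)\<close>; the loss \<open>ln \<rho> + ln \<sigma>\<close> is absorbed by the minors
  \<open>\<rho> a h \<le> x\<^sup>2\<close> and \<open>\<sigma> c h \<le> y\<^sup>2\<close>.\<close>

lemma log_bound_weighted:
  fixes a b c x y h \<rho> \<sigma> :: real
  assumes pos: "0 < a" "0 < b" "0 < c" and nonneg: "0 \<le> h" "0 \<le> x" "0 \<le> y"
    and ge1: "1 \<le> \<rho>" "1 \<le> \<sigma>"
    and newton: "\<And>\<beta>. \<rho> * a * (h + 2 * \<beta> * y + \<beta>\<^sup>2 * (\<sigma> * c)) \<le> (x + \<beta> * b)\<^sup>2"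
  shows "h * ln (b\<^sup>2 / (a * c)) \<le> x\<^sup>2 / a + y\<^sup>2 / c - 2 * x * y / b"
proof -
  define a' c' where "a' = \<rho> * a" and "c' = \<sigma> * c"
  have pos': "0 < a'" "0 < c'" using pos ge1 by (auto simp: a'_def c'_def)
  have "0 \<le> (x\<^sup>2 - a' * h) + 2 * (x * b - a' * y) * \<beta> + (b\<^sup>2 - a' * c') * \<beta>\<^sup>2" for \<beta>
    using newton[of \<beta>] unfolding a'_def[symmetric] c'_def[symmetric]
    by (simp add: algebra_simps power2_eq_square)
  note quad = quadratic_nonneg_imp[OF this]
  \<comment> \<open>The discriminant inequality has a factor a', which is cancelled next.\<close>
  have "0 \<le> a' * (2 * b * x * y - a' * y\<^sup>2 - c' * x\<^sup>2 - h * (b\<^sup>2 - a' * c'))"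
    using quad(3) by (simp add: algebra_simps power2_eq_square)
  then have det: "h * (b\<^sup>2 - a' * c') \<le> 2 * b * x * y - a' * y\<^sup>2 - c' * x\<^sup>2"
    using pos' by (simp add: zero_le_mult_iff)
  have ah: "a' * h \<le> x\<^sup>2" using quad(1) by simp
  have ch: "c' * h \<le> y\<^sup>2"
  proof (cases "x = 0")
    case True
    then have "h = 0" using ah nonneg pos' by (simp add: mult_le_0_iff)
    then show ?thesis by simp
  next
    case False
    \<comment> \<open>\<beta> = -x / b makes the square on the right vanish. Multiplying by h and
      completing the square then isolates c' h - y^2.\<close>
    have "a' * (h + 2 * (- x / b) * y + (- x / b)\<^sup>2 * c') \<le> 0"
      using newton[of "- x / b"] pos by (simp add: a'_def c'_def)
    then have "h + 2 * (- x / b) * y + (- x / b)\<^sup>2 * c' \<le> 0"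
      using pos' by (simp add: mult_le_0_iff)
    then have "h * b\<^sup>2 - 2 * x * y * b + x\<^sup>2 * c' \<le> 0"
      using pos by (simp add: field_simps power2_eq_square)
    then have "h * (h * b\<^sup>2 - 2 * x * y * b + x\<^sup>2 * c') \<le> 0"
      using nonneg by (simp add: mult_nonneg_nonpos)
    moreover have "h * (h * b\<^sup>2 - 2 * x * y * b + x\<^sup>2 * c') = (h * b - x * y)\<^sup>2 + x\<^sup>2 * (c' * h - y\<^sup>2)"
      by algebra
    ultimately have "x\<^sup>2 * (c' * h - y\<^sup>2) \<le> 0"
      by (smt (verit) zero_le_power2)
    then show ?thesis using False by (simp add: mult_le_0_iff)
  qed
  have "ln (b\<^sup>2 / (a * c)) = ln (b\<^sup>2 / (a' * c')) + ln \<rho> + ln \<sigma>"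
    using pos ge1 by (simp add: a'_def c'_def ln_div ln_mult)
  also have "\<dots> \<le> ln (b\<^sup>2 / (a' * c')) + (\<rho> - 1) + (\<sigma> - 1)"
    using ln_le_minus_one[of \<rho>] ln_le_minus_one[of \<sigma>] ge1 by simp
  finally have "h * ln (b\<^sup>2 / (a * c)) \<le> h * (ln (b\<^sup>2 / (a' * c')) + (\<rho> - 1) + (\<sigma> - 1))"
    using nonneg by (intro mult_left_mono)
  also have "\<dots> = h * ln (b\<^sup>2 / (a' * c')) + (\<rho> - 1) * h + (\<sigma> - 1) * h"
    by (simp add: algebra_simps)
  also have "\<dots> \<le> (x\<^sup>2 / a' + y\<^sup>2 / c' - 2 * x * y / b) + (\<rho> - 1) * (x\<^sup>2 / a') + (\<sigma> - 1) * (y\<^sup>2 / c')"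
    using quad(2) det ah ch ge1 pos pos' nonneg
    by (intro add_mono log_bound mult_left_mono) (auto simp: field_simps)
  also have "\<dots> = x\<^sup>2 / a + y\<^sup>2 / c - 2 * x * y / b"
    using pos ge1 by (simp add: a'_def c'_def field_simps)
  finally show ?thesis .
qed

text \<open>The Newton inequality for the weights d + (\<beta> / (k + 1)) p is the hypothesis
  \<open>newton\<close> of the weighted bound; k + 2 <= n keeps N - 1 positive.\<close>

lemma mass_log_bound:
  assumes p: "\<And>i. i < n \<Longrightarrow> 0 < p i \<and> p i < 1" and d: "\<And>i. i < n \<Longrightarrow> 0 \<le> d i"
    and k: "0 \<le> k" "k + 2 \<le> int n"
  shows "mass2 p d n k * ln ((mass p n (k + 1))\<^sup>2 / (mass p n k * mass p n (k + 2)))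
    \<le> (mass1 p d n k)\<^sup>2 / mass p n k + (mass1 p d n (k + 1))\<^sup>2 / mass p n (k + 2)
       - 2 * mass1 p d n k * mass1 p d n (k + 1) / mass p n (k + 1)"
proof -
  have p': "\<And>i. i < n \<Longrightarrow> 0 \<le> p i \<and> p i \<le> 1" using p by (auto intro: less_imp_le)
  define N where "N = real n - of_int k"
  define K where "K = real_of_int k + 1"
  have N: "2 \<le> N" using k unfolding N_def by linarith
  have K: "1 \<le> K" using k by (simp add: K_def)
  show ?thesis
  proof (rule log_bound_weighted[where \<rho> = "N / (N - 1)" and \<sigma> = "(K + 1) / K"])
    fix \<beta> :: real
    have "N * mass p n k * (mass2 p d n k + 2 * (\<beta> / K) * K * mass1 p d n (k + 1)
            + (\<beta> / K)\<^sup>2 * K * (K + 1) * mass p n (k + 2))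
          \<le> (N - 1) * (mass1 p d n k + (\<beta> / K) * K * mass p n (k + 1))\<^sup>2"
      using mass_newton[where n = n and p = p and k = k and d = "\<lambda>i. d i + \<beta> / K * p i", OF p]
      unfolding mass1_shift mass2_shift by (simp add: N_def K_def add.assoc)
    moreover have "(\<beta> / K)\<^sup>2 * K * (K + 1) = \<beta>\<^sup>2 * ((K + 1) / K)" "2 * (\<beta> / K) * K = 2 * \<beta>"
        "(\<beta> / K) * K = \<beta>"
      using K by (auto simp: field_simps power2_eq_square)
    ultimately have "N * mass p n k * (mass2 p d n k + 2 * \<beta> * mass1 p d n (k + 1)
            + \<beta>\<^sup>2 * ((K + 1) / K * mass p n (k + 2)))
          \<le> (N - 1) * (mass1 p d n k + \<beta> * mass p n (k + 1))\<^sup>2"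
      by (simp only: mult.assoc[symmetric])
    then show "N / (N - 1) * mass p n k * (mass2 p d n k + 2 * \<beta> * mass1 p d n (k + 1)
            + \<beta>\<^sup>2 * ((K + 1) / K * mass p n (k + 2)))
          \<le> (mass1 p d n k + \<beta> * mass p n (k + 1))\<^sup>2"
      using N by (simp add: pos_divide_le_eq mult.commute)
  qed (use N K k p d p' in \<open>auto intro!: mass_pos mass1_nonneg mass2_nonneg\<close>)
qed

section \<open>The second derivative of the entropy\<close>

text \<open>Differentiating the factor 1 - p_i + p_i z of the generating function gives w_i (z - 1),
  hence a backward difference of \<open>mass1\<close>.\<close>

lemma DERIV_mass:
  "((\<lambda>t. mass (\<lambda>i. A i + t * w i) n k) has_real_derivative
     mass1 (\<lambda>i. A i + t * w i) w n (k - 1) - mass1 (\<lambda>i. A i + t * w i) w n k) (at t)"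
proof (induction n arbitrary: k)
  case (Suc n)
  show ?case
    by (auto intro!: derivative_eq_intros Suc.IH simp: algebra_simps)
qed auto

lemma DERIV_mass1:
  "((\<lambda>t. mass1 (\<lambda>i. A i + t * w i) w n k) has_real_derivative
     mass2 (\<lambda>i. A i + t * w i) w n (k - 1) - mass2 (\<lambda>i. A i + t * w i) w n k) (at t)"
proof (induction n arbitrary: k)
  case (Suc n)
  show ?case
    by (auto intro!: derivative_eq_intros Suc.IH DERIV_mass simp: algebra_simps)
qed auto

lemma sum_shift_right:
  fixes u :: "int \<Rightarrow> real" and v :: "nat \<Rightarrow> real"
  assumes "u (-1) = 0"
  shows "(\<Sum>k=0..Suc m. u (int k - 1) * v k) = (\<Sum>k=0..m. u (int k) * v (Suc k))"
  using assms by (simp add: sum.atLeast0_atMost_Suc_shift del: sum.cl_ivl_Suc)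

text \<open>The sum is -H''. Summation by parts moves the second difference from \<open>h\<close> to
  the logarithms, which leaves one local bound for each triple of consecutive masses.\<close>

lemma entropy_second_derivative_nonneg:
  assumes p: "\<And>i. i < n \<Longrightarrow> 0 < p i \<and> p i < 1" and d: "\<And>i. i < n \<Longrightarrow> 0 \<le> d i" and "1 \<le> n"
  defines "f \<equiv> mass p n" and "g \<equiv> mass1 p d n" and "h \<equiv> mass2 p d n"
  shows "0 \<le> (\<Sum>k=0..n. (h (int k - 2) - 2 * h (int k - 1) + h (int k)) * (ln (f (int k)) + 1)
            + (g (int k - 1) - g (int k))\<^sup>2 / f (int k))"
proof -
  obtain m where n: "n = Suc m" using \<open>1 \<le> n\<close> by (cases n) auto
  define L where "L k = ln (f (int k)) + 1" for k
  define R where "R k = 1 / f (int k)" for k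
  have h0: "h (-1) = 0" "h (-2) = 0" "h (int m) = 0" "h (int m + 1) = 0"
    by (auto simp: h_def n mass2_eq_0 simp del: mass2.simps)
  have g0: "g (-1) = 0" "g (int m + 1) = 0"
    by (auto simp: g_def n mass1_eq_0 simp del: mass1.simps)
  have fpos: "0 < f (int k)" if "k \<le> n" for k
    unfolding f_def using that by (intro mass_pos p) auto
  have s0: "(\<Sum>k=0..n. h (int k) * L k) = (\<Sum>k<m. h (int k) * L k)"
    using h0 by (simp add: n atLeast0AtMost lessThan_Suc_atMost[symmetric] add.commute)
  have s1: "(\<Sum>k=0..n. h (int k - 1) * L k) = (\<Sum>k<m. h (int k) * L (k + 1))"
    using h0 sum_shift_right[of h L m]
    by (simp add: n atLeast0AtMost lessThan_Suc_atMost[symmetric] del: sum.atMost_Suc)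
  have s2: "(\<Sum>k=0..n. h (int k - 2) * L k) = (\<Sum>k<m. h (int k) * L (k + 2))"
  proof -
    have "(\<Sum>k=0..n. h (int k - 2) * L k) = (\<Sum>k=0..m. h (int k - 1) * L (Suc k))"
      using h0 sum_shift_right[of "\<lambda>j. h (j - 1)" L m] by (simp add: n)
    also have "\<dots> = (\<Sum>k<m. h (int k) * L (k + 2))"
    proof (cases m)
      case (Suc l)
      then show ?thesis
        using h0 sum_shift_right[of h "\<lambda>k. L (Suc k)" l]
        by (simp add: atLeast0AtMost lessThan_Suc_atMost)
    qed (use h0 in simp)
    finally show ?thesis .
  qed
  \<comment> \<open>There are m triples but m + 1 squares in each of \<open>g1\<close> and
    \<open>g2\<close>; the two surplus terms are nonnegative.\<close>
  have g1: "(\<Sum>k=0..n. (g (int k))\<^sup>2 * R k) = (\<Sum>k<m. (g (int k))\<^sup>2 * R k) + (g (int m))\<^sup>2 * R m"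
    using g0 by (simp add: n atLeast0AtMost lessThan_Suc_atMost[symmetric] add.commute)
  have g2: "(\<Sum>k=0..n. (g (int k - 1))\<^sup>2 * R k)
      = (\<Sum>k<m. (g (int k + 1))\<^sup>2 * R (k + 2)) + (g 0)\<^sup>2 * R 1"
    using g0 sum_shift_right[of "\<lambda>j. (g j)\<^sup>2" R m]
    by (simp add: n atLeast0AtMost sum.atMost_shift add.commute del: sum.atMost_Suc)
  have g3: "(\<Sum>k=0..n. (g (int k - 1) * g (int k)) * R k)
      = (\<Sum>k<m. (g (int k) * g (int k + 1)) * R (k + 1))"
    using g0 sum_shift_right[of "\<lambda>j. g j * g (j + 1)" R m]
    by (simp add: n atLeast0AtMost lessThan_Suc_atMost[symmetric] del: sum.atMost_Suc)
  have "(\<Sum>k=0..n. (h (int k - 2) - 2 * h (int k - 1) + h (int k)) * (ln (f (int k)) + 1)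
            + (g (int k - 1) - g (int k))\<^sup>2 / f (int k))
    = (\<Sum>k=0..n. h (int k - 2) * L k) - 2 * (\<Sum>k=0..n. h (int k - 1) * L k)
      + (\<Sum>k=0..n. h (int k) * L k) + (\<Sum>k=0..n. (g (int k - 1))\<^sup>2 * R k)
      + (\<Sum>k=0..n. (g (int k))\<^sup>2 * R k) - 2 * (\<Sum>k=0..n. (g (int k - 1) * g (int k)) * R k)"
    unfolding sum_distrib_left sum.distrib[symmetric] sum_subtractf[symmetric]
    by (intro sum.cong refl) (simp add: L_def R_def algebra_simps power2_eq_square add_divide_distrib diff_divide_distrib)
  also have "\<dots> = (\<Sum>k<m. h (int k) * (L k - 2 * L (k + 1) + L (k + 2)) + (g (int k))\<^sup>2 * R k
        + (g (int k + 1))\<^sup>2 * R (k + 2) - 2 * (g (int k) * g (int k + 1)) * R (k + 1))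
      + (g 0)\<^sup>2 * R 1 + (g (int m))\<^sup>2 * R m"
    unfolding s0 s1 s2 g1 g2 g3
    by (simp add: sum.distrib sum_subtractf sum_distrib_left algebra_simps)
  also have "\<dots> \<ge> 0"
  proof (intro add_nonneg_nonneg sum_nonneg)
    fix k assume "k \<in> {..<m}"
    then have k: "k + 2 \<le> n" by (simp add: n)
    have pos: "0 < f (int k)" "0 < f (int k + 1)" "0 < f (int k + 2)"
      using fpos[of k] fpos[of "k + 1"] fpos[of "k + 2"] k by (auto simp: add.commute)
    have "L k - 2 * L (k + 1) + L (k + 2) = - ln ((f (int k + 1))\<^sup>2 / (f (int k) * f (int k + 2)))"
      using pos by (simp add: L_def ln_div ln_mult ln_realpow add.commute)
    moreover have "h (int k) * ln ((f (int k + 1))\<^sup>2 / (f (int k) * f (int k + 2)))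
      \<le> (g (int k))\<^sup>2 / f (int k) + (g (int k + 1))\<^sup>2 / f (int k + 2)
        - 2 * g (int k) * g (int k + 1) / f (int k + 1)"
      unfolding f_def g_def h_def using k by (intro mass_log_bound p d) auto
    ultimately show "0 \<le> h (int k) * (L k - 2 * L (k + 1) + L (k + 2)) + (g (int k))\<^sup>2 * R k
        + (g (int k + 1))\<^sup>2 * R (k + 2) - 2 * (g (int k) * g (int k + 1)) * R (k + 1)"
      by (simp add: R_def add.commute)
  qed (use fpos[of 1] fpos[of m] in \<open>auto simp: R_def n\<close>)
  finally show ?thesis .
qed

lemma xlogx_eq: "xlogx = (\<lambda>x. x * ln x)"
  by (auto simp: xlogx_def)

text \<open>The strict bounds keep every parameter inside (0,1) on all of [0,1], so all masses are
  positive and the logarithms are differentiable even at the endpoints.\<close>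

lemma entropy_concave_interior:
  assumes A: "\<And>i. i < n \<Longrightarrow> 0 < A i" and Aw: "\<And>i. i < n \<Longrightarrow> A i + w i < 1"
    and w: "\<And>i. i < n \<Longrightarrow> 0 \<le> w i" and "1 \<le> n"
  shows "concave_on {0..1} (\<lambda>t. - (\<Sum>k=0..n. xlogx (mass (\<lambda>i. A i + t * w i) n (int k))))"
proof -
  define p where "p t i = A i + t * w i" for t i
  define f where "f k t = mass (p t) n k" for k t
  define g where "g k t = mass1 (p t) w n k" for k t
  define h where "h k t = mass2 (p t) w n k" for k t
  have p: "0 < p t i \<and> p t i < 1" if "t \<in> {0..1}" "i < n" for t i
  proof -
    have "0 \<le> t * w i" "t * w i \<le> w i"
      using that w[OF that(2)] mult_right_mono[of t 1 "w i"] by auto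
    then show ?thesis using A[OF that(2)] Aw[OF that(2)] by (simp add: p_def)
  qed
  have fpos: "0 < f (int k) t" if "t \<in> {0..1}" "k \<le> n" for k t
    unfolding f_def using that by (intro mass_pos p) auto
  have Df: "(f k has_real_derivative g (k - 1) t - g k t) (at t)" for k t
    using DERIV_mass[of A w n k t] by (simp add: f_def[abs_def] g_def p_def[abs_def])
  have Dg: "(g k has_real_derivative h (k - 1) t - h k t) (at t)" for k t
    using DERIV_mass1[of A w n k t] by (simp add: g_def[abs_def] h_def p_def[abs_def])
  have "concave_on {0..1} (\<lambda>t. - (\<Sum>k=0..n. f (int k) t * ln (f (int k) t)))"
  proof (rule f''_le0_imp_concave)
    fix t :: real assume t: "t \<in> {0..1}"
    show "((\<lambda>t. - (\<Sum>k=0..n. f (int k) t * ln (f (int k) t))) has_real_derivative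
      - (\<Sum>k=0..n. (g (int k - 1) t - g (int k) t) * (ln (f (int k) t) + 1))) (at t)"
    proof (intro DERIV_minus DERIV_sum)
      fix k assume "k \<in> {0..n}"
      then have "0 < f (int k) t" using fpos[OF t] by simp
      then show "((\<lambda>t. f (int k) t * ln (f (int k) t)) has_real_derivative
          (g (int k - 1) t - g (int k) t) * (ln (f (int k) t) + 1)) (at t)"
        by (auto intro!: derivative_eq_intros Df simp: distrib_left)
    qed
    show "((\<lambda>t. - (\<Sum>k=0..n. (g (int k - 1) t - g (int k) t) * (ln (f (int k) t) + 1)))
      has_real_derivative
      - (\<Sum>k=0..n. (h (int k - 2) t - 2 * h (int k - 1) t + h (int k) t) * (ln (f (int k) t) + 1)
            + (g (int k - 1) t - g (int k) t)\<^sup>2 / f (int k) t)) (at t)"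
    proof (intro DERIV_minus DERIV_sum)
      fix k assume "k \<in> {0..n}"
      then have "0 < f (int k) t" using fpos[OF t] by simp
      then show "((\<lambda>t. (g (int k - 1) t - g (int k) t) * (ln (f (int k) t) + 1)) has_real_derivative
          (h (int k - 2) t - 2 * h (int k - 1) t + h (int k) t) * (ln (f (int k) t) + 1)
            + (g (int k - 1) t - g (int k) t)\<^sup>2 / f (int k) t) (at t)"
        by (auto intro!: derivative_eq_intros Df Dg simp: power2_eq_square)
    qed
    show "- (\<Sum>k=0..n. (h (int k - 2) t - 2 * h (int k - 1) t + h (int k) t) * (ln (f (int k) t) + 1)
            + (g (int k - 1) t - g (int k) t)\<^sup>2 / f (int k) t) \<le> 0"
      using entropy_second_derivative_nonneg[OF p[OF t] w \<open>1 \<le> n\<close>]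
      by (simp add: f_def g_def h_def)
  qed simp
  then show ?thesis by (simp add: xlogx_eq f_def p_def[abs_def])
qed

section \<open>Identification of the masses and passage to the limit\<close>

lemma pmf_poibin:
  "(\<And>i. i < n \<Longrightarrow> 0 \<le> q i \<and> q i \<le> 1) \<Longrightarrow> pmf (poibin q n) k = mass q n (int k)"
proof (induction n arbitrary: k)
  case 0
  then show ?case by (auto simp: indicator_def)
next
  case (Suc n)
  have q: "0 \<le> q n" "q n \<le> 1" using Suc.prems[of n] by auto
  have IH: "pmf (poibin q n) j = mass q n (int j)" for j using Suc by simp
  \<comment> \<open>With the last Bernoulli draw outermost, \<open>pmf_bind\<close> yields a sum of
    two terms.\<close>
  have "poibin q (Suc n) = bind_pmf (bernoulli_pmf (q n))
      (\<lambda>b. map_pmf (\<lambda>s. s + (if b then 1 else 0)) (poibin q n))"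
    by (simp add: map_pmf_def bind_commute_pmf[of "poibin q n"])
  then have "pmf (poibin q (Suc n)) k
      = q n * pmf (map_pmf Suc (poibin q n)) k + (1 - q n) * pmf (poibin q n) k"
    using q by (simp add: pmf_bind)
  also have "pmf (map_pmf Suc (poibin q n)) k = mass q n (int k - 1)"
  proof (cases k)
    case 0
    then show ?thesis by (simp add: mass_eq_0 pmf_map_outside)
  next
    case (Suc j)
    then show ?thesis by (simp add: pmf_map_inj' IH)
  qed
  finally show ?case by (simp add: IH)
qed

text \<open>Since x ln x tends to 0 as x decreases to 0, \<open>xlogx\<close> is continuous on the
  closed half-line. This covers masses that vanish in the limit.\<close>

lemma tendsto_xlogx:
  assumes "(u \<longlongrightarrow> l) F" and "\<forall>\<^sub>F x in F. 0 \<le> u x"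
  shows "((\<lambda>x. xlogx (u x)) \<longlongrightarrow> xlogx l) F"
proof -
  have "continuous_on {0..} xlogx"
    unfolding continuous_on_def
  proof
    fix x :: real assume x: "x \<in> {0..}"
    show "(xlogx \<longlongrightarrow> xlogx x) (at x within {0..})"
    proof (cases "x = 0")
      case True
      have "((\<lambda>x::real. x * ln x) \<longlongrightarrow> 0) (at_right 0)" by real_asymp
      then show ?thesis using True by (simp add: xlogx_eq at_within_Ici_at_right)
    next
      case False
      then show ?thesis using x unfolding xlogx_eq
        by (intro tendsto_intros) auto
    qed
  qed
  moreover have "0 \<le> l \<or> F = bot"
    using assms tendsto_lowerbound by blast
  ultimately show ?thesis
    using assms by (auto intro: continuous_on_tendsto_compose)
qed

lemma tendsto_mass:
  "(\<And>i. ((\<lambda>x. p x i) \<longlongrightarrow> q i) F) \<Longrightarrow> ((\<lambda>x. mass (p x) n k) \<longlongrightarrow> mass q n k) F"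
  by (induction n arbitrary: k) (auto intro!: tendsto_intros)

lemma mass_cong: "(\<And>i. i < n \<Longrightarrow> p i = q i) \<Longrightarrow> mass p n k = mass q n k"
  by (induction n arbitrary: k) auto

lemma concave_on_limit:
  fixes f :: "'b \<Rightarrow> 'a::real_vector \<Rightarrow> real"
  assumes "F \<noteq> bot" "\<forall>\<^sub>F j in F. concave_on S (f j)" "\<And>x. x \<in> S \<Longrightarrow> ((\<lambda>j. f j x) \<longlongrightarrow> l x) F"
    and "convex S"
  shows "concave_on S l"
  unfolding concave_on_iff
proof (intro conjI ballI allI impI)
  fix x y and u v :: real
  assume xy: "x \<in> S" "y \<in> S" and uv: "0 \<le> u" "0 \<le> v" "u + v = 1"
  then have "u *\<^sub>R x + v *\<^sub>R y \<in> S" using \<open>convex S\<close> by (auto simp: convex_def)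
  moreover have "((\<lambda>j. u * f j x + v * f j y) \<longlongrightarrow> u * l x + v * l y) F"
    using xy by (intro tendsto_intros assms(3))
  moreover have "\<forall>\<^sub>F j in F. u * f j x + v * f j y \<le> f j (u *\<^sub>R x + v *\<^sub>R y)"
    using assms(2) by eventually_elim (use xy uv in \<open>auto simp: concave_on_iff\<close>)
  ultimately show "u * l x + v * l y \<le> l (u *\<^sub>R x + v *\<^sub>R y)"
    using tendsto_le[OF assms(1) assms(3)] by blast
qed fact

theorem theorem1p3:
  fixes n :: nat and p :: "nat \<Rightarrow> real \<Rightarrow> real"
  assumes "n \<ge> 1"
    and "\<And>i. i < n \<Longrightarrow> affine01 (p i)"
    and "\<And>i. i < n \<Longrightarrow> p i 0 \<le> p i 1"
  shows "concave_on {0..1}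
           (\<lambda>t. - (\<Sum>k = 0..n. xlogx (pmf (poibin (\<lambda>i. p i t) n) k)))"
proof -
  have p01: "0 \<le> p i 0" "p i 1 \<le> 1" if "i < n" for i
    using assms(2)[OF that] unfolding affine01_def atLeastAtMost_iff by blast+
  \<comment> \<open>Pulling the parameters towards 1/2 moves them into the open interval and keeps the
    functions affine and increasing.\<close>
  define A where "A \<epsilon> i = (1 - \<epsilon>) * p i 0 + \<epsilon> / 2" for \<epsilon> :: real and i
  define w where "w \<epsilon> i = (1 - \<epsilon>) * (p i 1 - p i 0)" for \<epsilon> :: real and i
  have Aw: "0 < A \<epsilon> i \<and> A \<epsilon> i + w \<epsilon> i < 1 \<and> 0 \<le> w \<epsilon> i"
    if "\<epsilon> \<in> {0<..<1}" "i < n" for \<epsilon> i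
  proof -
    have "A \<epsilon> i + w \<epsilon> i = (1 - \<epsilon>) * p i 1 + \<epsilon> / 2" by (simp add: A_def w_def algebra_simps)
    also have "\<dots> \<le> (1 - \<epsilon>) * 1 + \<epsilon> / 2"
      using that p01[of i] by (intro add_mono mult_left_mono) auto
    finally have "A \<epsilon> i + w \<epsilon> i < 1" using that by simp
    moreover have "0 < A \<epsilon> i" using that p01[of i] by (auto simp: A_def intro!: add_nonneg_pos)
    moreover have "0 \<le> w \<epsilon> i" using that assms(3)[of i] by (auto simp: w_def)
    ultimately show ?thesis by simp
  qed
  have ev: "\<forall>\<^sub>F \<epsilon> in at_right 0. \<epsilon> \<in> {0<..<1::real}"
    by (rule eventually_at_right_real) simp
  show ?thesis
  proof (rule concave_on_limit)
    show "\<forall>\<^sub>F \<epsilon> in at_right 0. concave_on {0..1}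
        (\<lambda>t. - (\<Sum>k=0..n. xlogx (mass (\<lambda>i. A \<epsilon> i + t * w \<epsilon> i) n (int k))))"
      using ev by eventually_elim (intro entropy_concave_interior assms(1), use Aw in auto)
    fix t :: real assume t: "t \<in> {0..1}"
    \<comment> \<open>\<open>tendsto_mass\<close> asks for convergence at every index, whereas
      \<open>p i t\<close> is known to be affine only for i < n; \<open>mass_cong\<close> bridges
      the two.\<close>
    have lim: "((\<lambda>\<epsilon>. A \<epsilon> i + t * w \<epsilon> i) \<longlongrightarrow> p i 0 + t * (p i 1 - p i 0)) (at_right 0)" for i
      unfolding A_def w_def by (auto intro!: tendsto_eq_intros)
    have pt: "p i t = p i 0 + t * (p i 1 - p i 0)" if "i < n" for i
    proof -
      have "p i t = (1 - t) * p i 0 + t * p i 1"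
        using assms(2)[OF that] t unfolding affine01_def by blast
      then show ?thesis by (simp add: algebra_simps)
    qed
    have pt01: "0 \<le> p i t \<and> p i t \<le> 1" if "i < n" for i
      using pt[OF that] p01[OF that] t assms(3)[OF that] mult_right_mono[of t 1 "p i 1 - p i 0"]
      by auto
    have mass_eq: "pmf (poibin (\<lambda>i. p i t) n) k = mass (\<lambda>i. p i 0 + t * (p i 1 - p i 0)) n (int k)" for k
      using pmf_poibin[OF pt01] mass_cong[OF pt] by simp
    have nonneg: "\<forall>\<^sub>F \<epsilon> in at_right 0. 0 \<le> mass (\<lambda>i. A \<epsilon> i + t * w \<epsilon> i) n k" for k
      using ev
    proof eventually_elim
      case (elim \<epsilon>)
      show ?case
      proof (rule mass_nonneg)
        fix i assume i: "i < n"
        show "0 \<le> A \<epsilon> i + t * w \<epsilon> i \<and> A \<epsilon> i + t * w \<epsilon> i \<le> 1"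
          using Aw[OF elim i] t mult_right_mono[of t 1 "w \<epsilon> i"] by auto
      qed
    qed
    show "((\<lambda>\<epsilon>. - (\<Sum>k=0..n. xlogx (mass (\<lambda>i. A \<epsilon> i + t * w \<epsilon> i) n (int k)))) \<longlongrightarrow>
       - (\<Sum>k=0..n. xlogx (pmf (poibin (\<lambda>i. p i t) n) k))) (at_right 0)"
      unfolding mass_eq by (intro tendsto_minus tendsto_sum tendsto_xlogx tendsto_mass lim nonneg)
  qed auto
qed

end
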